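(* Let $M$ be a subspace of a normed space $E$ and let $f\in M^*$. Then: (a) there exist $f_1,f_2\in extn(f)$ such that $f_1\neq f_2$ and $\|f_1\|=\|f_2\|$; (b) for every $r>\|f\|$, there exist at least two distinct $\widetilde f_1,\widetilde f_2\in extn(f)$ such that $\|\widetilde f_i\|=r$ for $i=1,2$.
   Context: Scalars are real; $E^*$ and $M^*$ are the continuous duals with the dual norms. For $f\in M^*$, $extn(f)=\{h\in E^*:h|_M=f\}$.
   Formalization: The formal theorem additionally assumes that M is not dense in E; without this the claim is false, since for dense M (e.g. M = E) each f has exactly one continuous extension, so extn(f) is a singleton. *)

theory Defs
  imports "HOL-Analysis.Analysis"
begin

text \<open>
  The ambient normed space is a type of class \<^class>\<open>real_normed_vector\<close>, so its continuous dual
  is the type of bounded linear functions into the reals, with the operator norm. The subspace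
  \<open>M\<close> is a set; an element of its dual is represented by a function on the whole space of
  which only the values on \<open>M\<close> matter.
\<close>

definition dual_on :: "'a::real_normed_vector set \<Rightarrow> ('a \<Rightarrow> real) set" where
  "dual_on M = {f. (\<forall>x\<in>M. \<forall>y\<in>M. f (x + y) = f x + f y) \<and>
                   (\<forall>c. \<forall>x\<in>M. f (c *\<^sub>R x) = c * f x) \<and>
                   continuous_on M f}"

text \<open>For a subspace \<open>M\<close> and \<open>f \<in> dual_on M\<close> the supremum is over a nonempty bounded set.\<close>

definition dual_norm_on :: "'a::real_normed_vector set \<Rightarrow> ('a \<Rightarrow> real) \<Rightarrow> real" where
  "dual_norm_on M f = (SUP x\<in>{x\<in>M. norm x \<le> 1}. \<bar>f x\<bar>)"

definition extn :: "'a::real_normed_vector set \<Rightarrow> ('a \<Rightarrow> real) \<Rightarrow> ('a \<Rightarrow>\<^sub>L real) set" where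
  "extn M f = {h. \<forall>x\<in>M. blinfun_apply h x = f x}"

end

theory Submission
  imports Defs
begin

text \<open>
  The Hahn-Banach theorem is obtained from minimal sublinear functionals: by Zorn's lemma there is
  one below any sublinear functional, and it is linear. It gives a norm-preserving
  extension \<open>h\<close> of \<open>f\<close> and, applied to the distance to \<open>M\<close>, a nonzero functional \<open>g\<close>
  vanishing on \<open>M\<close>. Along the line \<open>h + t g\<close> of extensions the norm is continuous and tends to
  infinity in both directions, so it attains every value above \<open>norm h\<close> for a positive and for a
  negative \<open>t\<close>.
\<close>

section \<open>Sublinear functionals\<close>

definition sublinear :: "('a::real_vector \<Rightarrow> real) \<Rightarrow> bool" where
  "sublinear p \<longleftrightarrow> (\<forall>x y. p (x + y) \<le> p x + p y) \<and> (\<forall>c\<ge>0. \<forall>x. p (c *\<^sub>R x) = c * p x)"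

lemma sublinear_add: "sublinear p \<Longrightarrow> p (x + y) \<le> p x + p y"
  by (simp add: sublinear_def)

lemma sublinear_scale: "sublinear p \<Longrightarrow> c \<ge> 0 \<Longrightarrow> p (c *\<^sub>R x) = c * p x"
  by (simp add: sublinear_def)

lemma sublinear_zero: "sublinear p \<Longrightarrow> p 0 = 0"
  using sublinear_scale[of p 0 0] by simp

lemma sublinear_minus: "sublinear p \<Longrightarrow> - p (- x) \<le> p x"
  using sublinear_add[of p x "- x"] sublinear_zero[of p] by simp

text \<open>One inequality for positive scalars suffices: applied to \<open>inverse c\<close> at the
  point \<open>c *\<^sub>R x\<close>, it gives the reverse one.\<close>

lemma sublinearI:
  assumes "\<And>x y. p (x + y) \<le> p x + p y" "p 0 = 0"
    and scale_le: "\<And>c x. c > 0 \<Longrightarrow> p (c *\<^sub>R x) \<le> c * p x"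
  shows "sublinear p"
  unfolding sublinear_def
proof (intro conjI allI impI)
  fix c :: real and x
  assume "c \<ge> 0"
  show "p (c *\<^sub>R x) = c * p x"
  proof (cases "c = 0")
    case False
    with \<open>c \<ge> 0\<close> have "c > 0" by simp
    have "p (inverse c *\<^sub>R (c *\<^sub>R x)) \<le> inverse c * p (c *\<^sub>R x)"
      using \<open>c > 0\<close> by (intro scale_le) simp
    then have "c * p x \<le> p (c *\<^sub>R x)"
      using \<open>c > 0\<close> by (simp add: field_simps)
    then show ?thesis using scale_le[OF \<open>c > 0\<close>, of x] by simp
  qed (use assms in simp)
qed (use assms in simp)

section \<open>Lowering a sublinear functional over a convex cone\<close>

locale superlinear_below =
  fixes p :: "'a::real_vector \<Rightarrow> real" and C :: "'a set" and g :: "'a \<Rightarrow> real"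
  assumes sublinear: "sublinear p"
    and zero_mem: "0 \<in> C"
    and add_mem: "\<And>x y. x \<in> C \<Longrightarrow> y \<in> C \<Longrightarrow> x + y \<in> C"
    and scale_mem: "\<And>c x. c \<ge> 0 \<Longrightarrow> x \<in> C \<Longrightarrow> c *\<^sub>R x \<in> C"
    and add_ge: "\<And>x y. x \<in> C \<Longrightarrow> y \<in> C \<Longrightarrow> g x + g y \<le> g (x + y)"
    and scale: "\<And>c x. c \<ge> 0 \<Longrightarrow> x \<in> C \<Longrightarrow> g (c *\<^sub>R x) = c * g x"
    and le: "\<And>x. x \<in> C \<Longrightarrow> g x \<le> p x"
begin

text \<open>This is the largest sublinear functional q below \<open>p\<close> with q (- c) \<le> - g
  c on \<open>C\<close>: any such q satisfies q x \<le> q (x + c) + q (- c) \<le> p (x + c) - g c. A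
  linear functional below it therefore lies between \<open>g\<close> and \<open>p\<close> on
  \<open>C\<close>.\<close>

definition lowered :: "'a \<Rightarrow> real" where
  "lowered x = (INF c\<in>C. p (x + c) - g c)"

lemma lowered_bdd_below: "bdd_below ((\<lambda>c. p (x + c) - g c) ` C)"
proof (rule bdd_belowI2)
  fix c assume "c \<in> C"
  then show "- p (- x) \<le> p (x + c) - g c"
    using sublinear_add[OF sublinear, of "- x" "x + c"] le[of c] by simp
qed

lemma lowered_le: "c \<in> C \<Longrightarrow> lowered x \<le> p (x + c) - g c"
  unfolding lowered_def by (rule cINF_lower[OF lowered_bdd_below])

lemma lowered_greatest: "(\<And>c. c \<in> C \<Longrightarrow> m \<le> p (x + c) - g c) \<Longrightarrow> m \<le> lowered x"
  unfolding lowered_def using zero_mem by (intro cINF_greatest) auto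

lemma g_zero: "g 0 = 0"
  using scale[of 0 0] zero_mem by simp

lemma lowered_le_self: "lowered x \<le> p x"
  using lowered_le[OF zero_mem, of x] g_zero by simp

lemma lowered_minus_le: "c \<in> C \<Longrightarrow> lowered (- c) \<le> - g c"
  using lowered_le[of c "- c"] sublinear_zero[OF sublinear] by simp

lemma sublinear_lowered: "sublinear lowered"
proof (rule sublinearI)
  fix x y
  \<comment> \<open>The two infima are taken one after the other: first over \<open>d\<close> with
    \<open>c\<close> fixed, then over \<open>c\<close>.\<close>
  have "lowered (x + y) - (p (x + c) - g c) \<le> lowered y" if "c \<in> C" for c
  proof (rule lowered_greatest)
    fix d assume "d \<in> C"
    have "lowered (x + y) \<le> p ((x + c) + (y + d)) - g (c + d)"
      using lowered_le[OF add_mem[OF that \<open>d \<in> C\<close>], of "x + y"] by (simp add: algebra_simps)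
    then show "lowered (x + y) - (p (x + c) - g c) \<le> p (y + d) - g d"
      using sublinear_add[OF sublinear, of "x + c" "y + d"] add_ge[OF that \<open>d \<in> C\<close>] by simp
  qed
  then have "lowered (x + y) - lowered y \<le> lowered x"
    by (intro lowered_greatest) (simp add: algebra_simps)
  then show "lowered (x + y) \<le> lowered x + lowered y" by simp
next
  show "lowered 0 = 0"
  proof (rule order_antisym)
    show "lowered 0 \<le> 0" using lowered_le_self[of 0] sublinear_zero[OF sublinear] by simp
    show "0 \<le> lowered 0" by (rule lowered_greatest) (simp add: le)
  qed
next
  fix c :: real and x
  assume "c > 0"
  have "lowered (c *\<^sub>R x) / c \<le> lowered x"
  proof (rule lowered_greatest)
    fix d assume "d \<in> C"
    have "lowered (c *\<^sub>R x) \<le> p (c *\<^sub>R (x + d)) - g (c *\<^sub>R d)"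
      using lowered_le[OF scale_mem, of c d "c *\<^sub>R x"] \<open>c > 0\<close> \<open>d \<in> C\<close>
      by (simp add: scaleR_add_right)
    also have "\<dots> = c * (p (x + d) - g d)"
      using \<open>c > 0\<close> \<open>d \<in> C\<close> by (simp add: scale sublinear_scale[OF sublinear] right_diff_distrib)
    finally show "lowered (c *\<^sub>R x) / c \<le> p (x + d) - g d"
      using \<open>c > 0\<close> by (simp add: field_simps)
  qed
  then show "lowered (c *\<^sub>R x) \<le> c * lowered x"
    using \<open>c > 0\<close> by (simp add: field_simps)
qed

end

section \<open>Minimal sublinear functionals\<close>

lemma superlinear_below_ray:
  assumes "sublinear p"
  shows "superlinear_below p ((\<lambda>t. t *\<^sub>R y) ` {0..}) p"
proof
  let ?C = "(\<lambda>t. t *\<^sub>R y) ` {0..}"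
  have mem: "t *\<^sub>R y \<in> ?C" if "t \<ge> 0" for t using that by (intro imageI) simp
  show "0 \<in> ?C" using mem[of 0] by simp
  show "u + v \<in> ?C" "p u + p v \<le> p (u + v)" if "u \<in> ?C" "v \<in> ?C" for u v
  proof -
    from that(1) obtain s where s: "u = s *\<^sub>R y" "s \<ge> 0" by blast
    from that(2) obtain t where t: "v = t *\<^sub>R y" "t \<ge> 0" by blast
    have sum: "u + v = (s + t) *\<^sub>R y" by (simp only: s t scaleR_add_left)
    then show "u + v \<in> ?C" using mem[of "s + t"] s(2) t(2) by simp
    \<comment> \<open>By positive homogeneity \<open>p\<close> is additive along a ray, so it can
      serve as its own minorant there.\<close>
    have "p (u + v) = (s + t) * p y"
      unfolding sum using s(2) t(2) by (intro sublinear_scale[OF assms]) simp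
    then show "p u + p v \<le> p (u + v)"
      using s t by (simp add: sublinear_scale[OF assms] distrib_right)
  qed
  show "c *\<^sub>R u \<in> ?C" if "c \<ge> 0" "u \<in> ?C" for c u
  proof -
    from that(2) obtain t where "u = t *\<^sub>R y" "t \<ge> 0" by blast
    then show ?thesis using mem[of "c * t"] that(1) by simp
  qed
qed (use assms in \<open>simp_all add: sublinear_scale\<close>)

text \<open>Lowering \<open>q\<close> along the ray through \<open>y\<close> gives \<open>q\<close> again by minimality, and comparing the two
  at the generator \<open>y\<close> yields superadditivity.\<close>

lemma minimal_sublinear_linear:
  assumes "sublinear q" and minimal: "\<And>q'. sublinear q' \<Longrightarrow> q' \<le> q \<Longrightarrow> q' = q"
  shows "linear q"
proof -
  have add: "q (x + y) = q x + q y" for x y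
  proof -
    interpret superlinear_below q "(\<lambda>t. t *\<^sub>R y) ` {0..}" q
      by (rule superlinear_below_ray[OF assms(1)])
    have "lowered = q"
      by (intro minimal sublinear_lowered le_funI lowered_le_self)
    moreover have "y \<in> (\<lambda>t. t *\<^sub>R y) ` {0..}" by (rule image_eqI[of _ _ 1]) auto
    ultimately have "q x \<le> q (x + y) - q y" using lowered_le[of y x] by simp
    then show ?thesis using sublinear_add[OF assms(1), of x y] by simp
  qed
  have minus: "q (- x) = - q x" for x
    using add[of x "- x"] sublinear_zero[OF assms(1)] by simp
  show ?thesis
  proof (rule linearI)
    fix c x
    show "q (c *\<^sub>R x) = c *\<^sub>R q x"
    proof (cases "c \<ge> 0")
      case False
      then have "q (c *\<^sub>R x) = - q ((- c) *\<^sub>R x)" by (simp flip: minus)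
      with False show ?thesis using sublinear_scale[OF assms(1), of "- c" x] by simp
    qed (simp add: sublinear_scale[OF assms(1)])
  qed (rule add)
qed

text \<open>Supplies the bounds for Zorn's lemma. The pointwise infimum is finite because each
  member satisfies q x \<ge> - q (- x) \<ge> - p (- x).\<close>

lemma sublinear_INF_chain:
  assumes "Q \<noteq> {}" and sub: "\<And>q. q \<in> Q \<Longrightarrow> sublinear q"
    and le: "\<And>q. q \<in> Q \<Longrightarrow> q \<le> p"
    and chain: "\<And>q q'. q \<in> Q \<Longrightarrow> q' \<in> Q \<Longrightarrow> q \<le> q' \<or> q' \<le> q"
  shows "sublinear (\<lambda>x. INF q\<in>Q. q x)" and "q \<in> Q \<Longrightarrow> (\<lambda>x. INF q\<in>Q. q x) \<le> q"
proof -
  let ?m = "\<lambda>x. INF q\<in>Q. q x"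
  have bdd: "bdd_below ((\<lambda>q. q x) ` Q)" for x
  proof (rule bdd_belowI2)
    fix q assume "q \<in> Q"
    then show "- p (- x) \<le> q x"
      using sublinear_minus[OF sub, of q x] le_funD[OF le, of q "- x"] by linarith
  qed
  have lower: "?m x \<le> q x" if "q \<in> Q" for q x
    by (rule cINF_lower[OF bdd that])
  have greatest: "m \<le> ?m x" if "\<And>q. q \<in> Q \<Longrightarrow> m \<le> q x" for m x
    using assms(1) that by (rule cINF_greatest)
  show "?m \<le> q" if "q \<in> Q" using lower[OF that] by (rule le_funI)
  show "sublinear ?m"
  proof (rule sublinearI)
    fix x y
    have "?m (x + y) - q x \<le> q' y" if mem: "q \<in> Q" "q' \<in> Q" for q q'
    proof -
      \<comment> \<open>Subadditivity is where the chain condition enters: the smaller of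
        \<open>q\<close> and \<open>q'\<close> bounds both terms at once.\<close>
      obtain r where "r \<in> Q" "r \<le> q" "r \<le> q'" using chain[OF mem] mem by blast
      then show ?thesis
        using lower[OF \<open>r \<in> Q\<close>, of "x + y"] sublinear_add[OF sub[OF \<open>r \<in> Q\<close>], of x y]
          le_funD[OF \<open>r \<le> q\<close>, of x] le_funD[OF \<open>r \<le> q'\<close>, of y] by linarith
    qed
    then have *: "?m (x + y) - q x \<le> ?m y" if "q \<in> Q" for q
      using that by (intro greatest)
    have "?m (x + y) - ?m y \<le> ?m x"
    proof (rule greatest)
      show "?m (x + y) - ?m y \<le> q x" if "q \<in> Q" for q using *[OF that] by linarith
    qed
    then show "?m (x + y) \<le> ?m x + ?m y" by simp
  next
    have "?m 0 = (INF q\<in>Q. 0)" by (intro INF_cong refl sublinear_zero sub)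
    then show "?m 0 = 0" using assms(1) by simp
  next
    fix c :: real and x
    assume "c > 0"
    have "?m (c *\<^sub>R x) / c \<le> ?m x"
    proof (rule greatest)
      fix q assume "q \<in> Q"
      then show "?m (c *\<^sub>R x) / c \<le> q x"
        using lower[OF \<open>q \<in> Q\<close>, of "c *\<^sub>R x"] sublinear_scale[OF sub, of q c x] \<open>c > 0\<close>
        by (simp add: field_simps)
    qed
    then show "?m (c *\<^sub>R x) \<le> c * ?m x" using \<open>c > 0\<close> by (simp add: field_simps)
  qed
qed

lemma ex_minimal_sublinear:
  fixes p :: "'a::real_vector \<Rightarrow> real"
  assumes "sublinear p"
  obtains q where "sublinear q" "q \<le> p" "\<And>q'. sublinear q' \<Longrightarrow> q' \<le> q \<Longrightarrow> q' = q"
proof -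
  define A where "A = {q. sublinear q \<and> q \<le> p}"
  \<comment> \<open>Zorn's lemma is applied to the reversed order, so that a maximal element is a
    minimal functional. The empty chain is bounded by \<open>p\<close> itself.\<close>
  have "\<exists>m\<in>A. \<forall>q\<in>A. m \<ge> q \<longrightarrow> q = m"
  proof (rule predicate_Zorn)
    show "partial_order_on A (relation_of (\<ge>) A)"
      by (rule partial_order_on_relation_ofI) auto
  next
    fix Q assume "Q \<in> Chains (relation_of (\<ge>) A)"
    then have Q: "Q \<subseteq> A" "\<And>q q'. q \<in> Q \<Longrightarrow> q' \<in> Q \<Longrightarrow> q \<le> q' \<or> q' \<le> q"
      unfolding Chains_def relation_of_def by auto
    show "\<exists>u\<in>A. \<forall>q\<in>Q. q \<ge> u"
    proof (cases "Q = {}")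
      case True
      then show ?thesis using assms by (auto simp: A_def)
    next
      case False
      then obtain q0 where "q0 \<in> Q" by blast
      have sub: "sublinear q" "q \<le> p" if "q \<in> Q" for q using that Q(1) by (auto simp: A_def)
      have inf: "sublinear (\<lambda>x. INF q\<in>Q. q x)" "q \<in> Q \<Longrightarrow> (\<lambda>x. INF q\<in>Q. q x) \<le> q" for q
        using sublinear_INF_chain[where Q = Q and p = p] False sub Q(2) by blast+
      have "(\<lambda>x. INF q\<in>Q. q x) \<in> A"
        using inf(1) order_trans[OF inf(2)[OF \<open>q0 \<in> Q\<close>] sub(2)[OF \<open>q0 \<in> Q\<close>]]
        by (simp add: A_def)
      then show ?thesis using inf(2) by blast
    qed
  qed
  then show thesis using that unfolding A_def by (blast intro: order_trans)
qed

section \<open>The Hahn-Banach theorem and functionals on normed spaces\<close>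

theorem (in superlinear_below) Hahn_Banach_sandwich:
  obtains h where "linear h" "\<And>x. h x \<le> p x" "\<And>x. x \<in> C \<Longrightarrow> g x \<le> h x"
proof -
  obtain h where h: "sublinear h" "h \<le> lowered" "\<And>q'. sublinear q' \<Longrightarrow> q' \<le> h \<Longrightarrow> q' = h"
    using ex_minimal_sublinear[OF sublinear_lowered] by blast
  have "linear h" using h(1,3) by (rule minimal_sublinear_linear)
  moreover have "h x \<le> p x" for x
    using le_funD[OF h(2), of x] lowered_le_self[of x] by linarith
  \<comment> \<open>By linearity h x = - h (- x), and h (- x) \<le> lowered (- x) \<le> - g
    x.\<close>
  moreover have "g x \<le> h x" if "x \<in> C" for x
    using le_funD[OF h(2), of "- x"] lowered_minus_le[OF that] linear_neg[OF \<open>linear h\<close>, of x]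
    by linarith
  ultimately show thesis by (rule that)
qed

lemma linear_norm_bound_blinfun:
  fixes h :: "'a::real_normed_vector \<Rightarrow> real"
  assumes "linear h" "\<And>x. h x \<le> K * norm x" "K \<ge> 0"
  obtains H where "blinfun_apply H = h" "norm H \<le> K"
proof -
  \<comment> \<open>The one-sided bound at both \<open>x\<close> and \<open>- x\<close> controls the
    absolute value.\<close>
  have bound: "norm (h x) \<le> K * norm x" for x
    using assms(2)[of x] assms(2)[of "- x"] linear_neg[OF assms(1), of x] by (simp add: abs_le_iff)
  then have "bounded_linear h"
    using assms(1) by (intro bounded_linear.intro bounded_linear_axioms.intro exI[of _ K])
      (simp_all only: mult.commute[of _ K] simp_thms)
  then have "blinfun_apply (Blinfun h) = h" by (rule bounded_linear_Blinfun_apply)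
  with bound assms(3) show thesis by (intro that[of "Blinfun h"] norm_blinfun_bound) auto
qed

lemma sublinear_scaled_norm:
  assumes "K \<ge> 0"
  shows "sublinear (\<lambda>x::'a::real_normed_vector. K * norm x)"
proof (rule sublinearI)
  show "K * norm (x + y) \<le> K * norm x + K * norm y" for x y :: 'a
    using mult_left_mono[OF norm_triangle_ineq assms] by (simp only: distrib_left)
qed simp_all

text \<open>A linear functional dominated by the distance to \<open>M\<close> vanishes on
  \<open>M\<close>, since it is nonpositive at both \<open>x\<close> and \<open>- x\<close>.
  Prescribing its value at a point at positive distance keeps it nonzero.\<close>

lemma ex_annihilator:
  fixes M :: "'a::real_normed_vector set"
  assumes "subspace M" "closure M \<noteq> UNIV"
  obtains g :: "'a \<Rightarrow>\<^sub>L real" where "g \<noteq> 0" "\<And>x. x \<in> M \<Longrightarrow> g x = 0"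
proof -
  obtain z where z: "z \<notin> closure M" using assms(2) by blast
  \<comment> \<open>Here \<open>D.lowered\<close> is the distance to \<open>M\<close>.\<close>
  interpret D: superlinear_below norm M "\<lambda>_. 0"
    using sublinear_scaled_norm[of 1] assms(1)
    by unfold_locales (auto simp: subspace_def)
  have M_le: "D.lowered x \<le> 0" if "x \<in> M" for x
    using D.lowered_minus_le[of "- x"] subspace_neg[OF assms(1) that] by simp
  obtain e where e: "e > 0" "\<And>y. y \<in> M \<Longrightarrow> e \<le> dist y z"
    using z unfolding closure_approachable by (meson not_le)
  have "e \<le> D.lowered z"
  proof (rule D.lowered_greatest)
    fix c assume "c \<in> M"
    then show "e \<le> norm (z + c) - 0"
      using e(2)[of "- c"] subspace_neg[OF assms(1)] by (simp add: dist_norm norm_minus_commute)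
  qed
  \<comment> \<open>A second lowering, now of the distance along the ray through \<open>z\<close>,
    forces h z \<ge> D.lowered z \<ge> e > 0.\<close>
  interpret R: superlinear_below D.lowered "(\<lambda>t. t *\<^sub>R z) ` {0..}" D.lowered
    by (rule superlinear_below_ray[OF D.sublinear_lowered])
  obtain h where h: "linear h" "\<And>x. h x \<le> D.lowered x"
    and ge: "\<And>x. x \<in> (\<lambda>t. t *\<^sub>R z) ` {0..} \<Longrightarrow> D.lowered x \<le> h x"
    using R.Hahn_Banach_sandwich by blast
  have "D.lowered z \<le> h z" by (intro ge image_eqI[of _ _ 1]) auto
  with e(1) \<open>e \<le> D.lowered z\<close> have "h z > 0" by linarith
  have "h x \<le> 1 * norm x" for x using h(2)[of x] D.lowered_le_self[of x] by simp
  then obtain H where H: "blinfun_apply H = h"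
    using linear_norm_bound_blinfun[OF h(1), of 1] by auto
  have "h x = 0" if "x \<in> M" for x
    using h(2)[of x] h(2)[of "- x"] M_le[OF that] M_le[OF subspace_neg[OF assms(1) that]]
      linear_neg[OF h(1), of x] by linarith
  moreover have "H \<noteq> 0" using H \<open>h z > 0\<close> by auto
  ultimately show thesis using that[of H] H by simp
qed

section \<open>The dual norm on a subspace and norm-preserving extension\<close>

lemma dual_on_scale: "f \<in> dual_on M \<Longrightarrow> x \<in> M \<Longrightarrow> f (c *\<^sub>R x) = c * f x"
  by (simp add: dual_on_def)

lemma dual_on_bounded:
  assumes "subspace M" "f \<in> dual_on M"
  obtains K where "\<And>x. x \<in> M \<Longrightarrow> \<bar>f x\<bar> \<le> K * norm x"
proof -
  have "0 \<in> M" using assms(1) by (rule subspace_0)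
  then have f0: "f 0 = 0" using dual_on_scale[OF assms(2), of 0 0] by simp
  have "continuous_on M f" using assms(2) by (simp add: dual_on_def)
  then obtain d where "d > 0" "\<And>x. x \<in> M \<Longrightarrow> dist x 0 \<le> d \<Longrightarrow> dist (f x) (f 0) < 1"
    using \<open>0 \<in> M\<close> zero_less_one by (rule continuous_onE) blast
  then have d: "d > 0" "\<And>x. x \<in> M \<Longrightarrow> norm x \<le> d \<Longrightarrow> \<bar>f x\<bar> < 1"
    by (simp_all add: f0)
  have "\<bar>f x\<bar> \<le> 1 / d * norm x" if "x \<in> M" for x
  proof (cases "x = 0")
    case False
    \<comment> \<open>Rescales \<open>x\<close> to norm \<open>d\<close>, where continuity at 0
      gives the bound 1.\<close>
    define c where "c = d / norm x"
    have "c > 0" using d(1) False by (simp add: c_def)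
    have "\<bar>f (c *\<^sub>R x)\<bar> < 1"
      using False d(1) by (intro d(2) subspace_scale[OF assms(1) that]) (simp add: c_def)
    then have "c * \<bar>f x\<bar> < 1"
      using \<open>c > 0\<close> by (simp add: dual_on_scale[OF assms(2) that] abs_mult)
    then show ?thesis using False d(1) by (simp add: c_def field_simps)
  qed (simp add: f0)
  then show thesis by (rule that)
qed

lemma dual_norm_on_bound:
  assumes "subspace M" "f \<in> dual_on M"
  shows "0 \<le> dual_norm_on M f" and "x \<in> M \<Longrightarrow> \<bar>f x\<bar> \<le> dual_norm_on M f * norm x"
proof -
  obtain K where K: "\<And>x. x \<in> M \<Longrightarrow> \<bar>f x\<bar> \<le> K * norm x"
    using dual_on_bounded[OF assms] by blast
  have bdd: "bdd_above ((\<lambda>x. \<bar>f x\<bar>) ` {x\<in>M. norm x \<le> 1})"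
  proof (rule bdd_aboveI2)
    fix x assume "x \<in> {x\<in>M. norm x \<le> 1}"
    then have "\<bar>f x\<bar> \<le> K * norm x" "norm x \<le> 1" using K by auto
    \<comment> \<open>The sign of \<open>K\<close> is unknown: if \<open>M\<close> is {0}, any
      \<open>K\<close> satisfies the bound.\<close>
    moreover have "K * norm x \<le> \<bar>K\<bar> * norm x" by (simp add: mult_right_mono)
    moreover have "\<bar>K\<bar> * norm x \<le> \<bar>K\<bar>" using \<open>norm x \<le> 1\<close> by (simp add: mult_left_le)
    ultimately show "\<bar>f x\<bar> \<le> \<bar>K\<bar>" by linarith
  qed
  have upper: "\<bar>f x\<bar> \<le> dual_norm_on M f" if "x \<in> M" "norm x \<le> 1" for x
    unfolding dual_norm_on_def using that by (intro cSUP_upper[OF _ bdd]) auto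
  have "0 \<in> M" using assms(1) by (rule subspace_0)
  then show "0 \<le> dual_norm_on M f" using upper[of 0] by simp
  show "\<bar>f x\<bar> \<le> dual_norm_on M f * norm x" if "x \<in> M"
  proof (cases "x = 0")
    case True
    then show ?thesis using dual_on_scale[OF assms(2) \<open>0 \<in> M\<close>, of 0] by simp
  next
    case False
    have "\<bar>f (inverse (norm x) *\<^sub>R x)\<bar> \<le> dual_norm_on M f"
      using False by (intro upper subspace_scale[OF assms(1) that]) simp
    then show ?thesis
      using False by (simp add: dual_on_scale[OF assms(2) that] abs_mult field_simps)
  qed
qed

text \<open>The sandwich theorem between \<open>f\<close> on the cone \<open>M\<close> and the
  scaled norm gives only f \<le> h on \<open>M\<close>; since \<open>M\<close> also contains
  \<open>- x\<close>, equality follows.\<close>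

lemma ex_extn_norm_le:
  assumes "subspace M" "f \<in> dual_on M"
  obtains h where "h \<in> extn M f" "norm h \<le> dual_norm_on M f"
proof -
  let ?K = "dual_norm_on M f"
  note K = dual_norm_on_bound[OF assms]
  interpret superlinear_below "\<lambda>x. ?K * norm x" M f
  proof
    show "f x \<le> ?K * norm x" if "x \<in> M" for x using K(2)[OF that] by linarith
  qed (use assms in \<open>auto simp: sublinear_scaled_norm[OF K(1)] dual_on_def subspace_def\<close>)
  obtain h where h: "linear h" "\<And>x. h x \<le> ?K * norm x" "\<And>x. x \<in> M \<Longrightarrow> f x \<le> h x"
    using Hahn_Banach_sandwich by blast
  obtain H where H: "blinfun_apply H = h" "norm H \<le> ?K"
    using linear_norm_bound_blinfun[OF h(1,2) K(1)] .
  have "h x = f x" if "x \<in> M" for x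
  proof -
    have "f (- x) = - f x" using dual_on_scale[OF assms(2) that, of "-1"] by simp
    then show ?thesis
      using h(3)[OF that] h(3)[OF subspace_neg[OF assms(1) that]] linear_neg[OF h(1), of x]
      by linarith
  qed
  then show thesis using that[of H] H by (simp add: extn_def)
qed

section \<open>Norms along a line of extensions\<close>

lemma ex_norm_eq_on_ray:
  fixes h g :: "'a::real_normed_vector"
  assumes "g \<noteq> 0" "norm h < r"
  obtains t where "t > 0" "norm (h + t *\<^sub>R g) = r"
proof -
  \<comment> \<open>Chosen so that \<open>T *\<^sub>R g\<close> has norm \<open>r + norm h\<close>;
    the reverse triangle inequality then gives norm at least \<open>r\<close> at \<open>T\<close>.
    At parameter 0 the norm is below \<open>r\<close>, so the intermediate value theorem
    applies.\<close>
  define T where "T = (r + norm h) / norm g"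
  have "r > 0" using assms(2) norm_ge_zero[of h] by linarith
  then have "T \<ge> 0" by (simp add: T_def)
  then have "norm (T *\<^sub>R g) = T * norm g" by simp
  also have "\<dots> = r + norm h" using assms(1) by (simp add: T_def)
  finally have "norm (T *\<^sub>R g) = r + norm h" .
  then have "r \<le> norm (h + T *\<^sub>R g)"
    using norm_diff_ineq[of "T *\<^sub>R g" h] by (simp add: add.commute)
  then have "\<exists>t\<ge>0. t \<le> T \<and> norm (h + t *\<^sub>R g) = r"
    using assms(2) \<open>T \<ge> 0\<close> by (intro IVT') (auto intro!: continuous_intros)
  then obtain t where "t \<ge> 0" "norm (h + t *\<^sub>R g) = r" by blast
  moreover from this have "t \<noteq> 0" using assms(2) by auto
  ultimately show thesis by (intro that[of t]) auto
qed

lemma ex_two_norm_eq_on_line: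
  fixes h g :: "'a::real_normed_vector"
  assumes "g \<noteq> 0" "norm h < r"
  obtains s t where "h + s *\<^sub>R g \<noteq> h + t *\<^sub>R g" "norm (h + s *\<^sub>R g) = r" "norm (h + t *\<^sub>R g) = r"
proof -
  obtain s where s: "s > 0" "norm (h + s *\<^sub>R g) = r" using ex_norm_eq_on_ray[OF assms] .
  obtain t where t: "t > 0" "norm (h + t *\<^sub>R - g) = r"
    using ex_norm_eq_on_ray[of "- g" h r] assms by auto
  \<comment> \<open>The solutions in the directions \<open>g\<close> and \<open>- g\<close> have
    parameters of opposite sign on the same line, hence differ.\<close>
  have "s *\<^sub>R g \<noteq> (- t) *\<^sub>R g" unfolding scaleR_cancel_right using s(1) t(1) assms(1) by simp
  then show thesis using that[of s "- t"] s t by simp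
qed

theorem corollary2p17:
  fixes M :: "'a::real_normed_vector set"
    and f :: "'a \<Rightarrow> real"
  assumes "subspace M"
    and "closure M \<noteq> UNIV"
    and "f \<in> dual_on M"
  shows "(\<exists>f1\<in>extn M f. \<exists>f2\<in>extn M f. f1 \<noteq> f2 \<and> norm f1 = norm f2) \<and>
         (\<forall>r>dual_norm_on M f. \<exists>g1\<in>extn M f. \<exists>g2\<in>extn M f.
            g1 \<noteq> g2 \<and> norm g1 = r \<and> norm g2 = r)"
proof -
  obtain h where h: "h \<in> extn M f" "norm h \<le> dual_norm_on M f"
    using ex_extn_norm_le[OF assms(1,3)] .
  obtain g :: "'a \<Rightarrow>\<^sub>L real" where g: "g \<noteq> 0" "\<And>x. x \<in> M \<Longrightarrow> g x = 0"
    using ex_annihilator[OF assms(1,2)] by blast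
  have line: "h + t *\<^sub>R g \<in> extn M f" for t
    using h(1) g(2) by (simp add: extn_def blinfun.add_left blinfun.scaleR_left)
  have two: "\<exists>g1\<in>extn M f. \<exists>g2\<in>extn M f. g1 \<noteq> g2 \<and> norm g1 = r \<and> norm g2 = r"
    if "r > dual_norm_on M f" for r
    using ex_two_norm_eq_on_line[OF g(1), of h r] h(2) that line by (metis order_le_less_trans)
  \<comment> \<open>Part (a) is part (b) at a single radius; any value above the dual norm would
    do.\<close>
  moreover have "\<exists>f1\<in>extn M f. \<exists>f2\<in>extn M f. f1 \<noteq> f2 \<and> norm f1 = norm f2"
    using two[of "dual_norm_on M f + 1"] by force
  ultimately show ?thesis by blast
qed

end
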